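(* Let $X_1,X_2,\ldots$ be a Markov chain with kernel $P$ and initial distribution $X_1\sim q$, and let $$Z:=\frac{1}{N-t_0}\sum_{i=t_0+1}^{N}f(X_i),$$ where $t_0$ is the burn-in time. Then for any Lipschitz $f:\Omega\to\mathbb{R}$ with Lipschitz coefficient $\|f\|_{\mathrm{Lip}}$, $$|\mathbb{E}_{q}(Z)-\mathbb{E}_{\pi}(f)|\le\frac{(1-\kappa_{t_0+1})\,\kappa_{\Sigma}^c}{N-t_0}\,W_1(q,\pi)\,\|f\|_{\mathrm{Lip}} .$$
   Context: $(\Omega,d)$ is a Polish metric space and $P(x,\mathrm{d}y)$ is a Markov kernel on $\Omega$, measurable in $x$, with stationary distribution $\pi$; $P_x=P(x,\cdot)$, and $W_1(\delta_x,P_x)<\infty$ for every $x$. $P^k_x$ is the $k$-step kernel started from $x$, $P^0_x=\delta_x$. $W_1(\mu_1,\mu_2)=\inf\mathbb{E}(d(X,Y))$ over all couplings $(X,Y)$ of $\mu_1,\mu_2$. $\mathbb{E}_q$ denotes expectation for the chain with initial distribution $q$, and $\mathbb{E}_\pi(f)$ is the expectation of $f$ under $\pi$. $N$ and $t_0$ are integers with $0\le t_0<N$. Multi-step coarse Ricci curvature: $\kappa_k(x,y)=1-W_1(P^k_x,P^k_y)/d(x,y)$ for $x\ne y$, $\kappa_k(x,x)=1$, $\kappa_k=\inf_{x,y\in\Omega}\kappa_k(x,y)$, and $\kappa_\Sigma^c=\sum_{k=0}^\infty(1-\kappa_k)$.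
   Formalization: The chain starts at time 0 (X_0 ~ q, so X_1 ~ qP), since with X_1 ~ q the bound fails for P_x = π, t_0 = 0, N = 1, q ≠ π; if κ_Σ^c is infinite, f is assumed π-integrable so that E_π(f) exists. *)

theory Defs
  imports "HOL-Probability.Probability"
begin

definition couplings :: "'a::polish_space measure \<Rightarrow> 'a measure \<Rightarrow> ('a \<times> 'a) measure set" where
  "couplings \<mu> \<nu> = {\<gamma>. prob_space \<gamma> \<and> sets \<gamma> = sets (borel \<Otimes>\<^sub>M borel) \<and>
     distr \<gamma> borel fst = \<mu> \<and> distr \<gamma> borel snd = \<nu>}"

definition W1 :: "'a::polish_space measure \<Rightarrow> 'a measure \<Rightarrow> ennreal" where
  "W1 \<mu> \<nu> = (INF \<gamma>\<in>couplings \<mu> \<nu>. \<integral>\<^sup>+ z. ennreal (dist (fst z) (snd z)) \<partial>\<gamma>)"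

primrec kernel_pow :: "('a::polish_space \<Rightarrow> 'a measure) \<Rightarrow> nat \<Rightarrow> 'a \<Rightarrow> 'a measure" where
  "kernel_pow P 0 x = return borel x"
| "kernel_pow P (Suc k) x = kernel_pow P k x \<bind> P"

definition stationary :: "('a::polish_space \<Rightarrow> 'a measure) \<Rightarrow> 'a measure \<Rightarrow> bool" where
  "stationary P \<pi> \<longleftrightarrow> \<pi> \<in> space (prob_algebra borel) \<and> \<pi> \<bind> P = \<pi>"

text \<open>Curvatures are extended reals: the k-step laws may be at infinite distance, in which case
  the curvature is minus infinity.\<close>

definition curv_at :: "('a::polish_space \<Rightarrow> 'a measure) \<Rightarrow> nat \<Rightarrow> 'a \<Rightarrow> 'a \<Rightarrow> ereal" where
  "curv_at P k x y = (if x = y then 1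
     else 1 - enn2ereal (W1 (kernel_pow P k x) (kernel_pow P k y)) / ereal (dist x y))"

definition curv :: "('a::polish_space \<Rightarrow> 'a measure) \<Rightarrow> nat \<Rightarrow> ereal" where
  "curv P k = (INF x. INF y. curv_at P k x y)"

definition curv_sum_c :: "('a::polish_space \<Rightarrow> 'a measure) \<Rightarrow> ereal" where
  "curv_sum_c P = (\<Sum>k. 1 - curv P k)"

text \<open>Pairs with \<open>x = y\<close> contribute \<open>0 / 0 = 0\<close>, so this is the supremum over distinct points, and 0
  on a one-point space.\<close>

definition lip_coeff :: "('a::metric_space \<Rightarrow> real) \<Rightarrow> real" where
  "lip_coeff f = (SUP (x, y)\<in>UNIV. \<bar>f x - f y\<bar> / dist x y)"

definition past :: "'b measure \<Rightarrow> (nat \<Rightarrow> 'b \<Rightarrow> 'a::topological_space) \<Rightarrow> nat \<Rightarrow> 'b measure" where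
  "past M X n = sigma (space M) {X i -` A \<inter> space M | i A. i \<le> n \<and> A \<in> sets borel}"

text \<open>The initial distribution \<open>q\<close> is the law of the chain at time 0, so \<open>X i\<close> has law \<open>q P\<^sup>i\<close>. The
  factor with index \<open>t0 + 1\<close> in the bias bound belongs to this indexing: if the first averaged
  state \<open>X (t0 + 1)\<close> were only \<open>t0\<close> steps away from \<open>q\<close>, the bound would fail for the kernel
  \<open>P x = \<pi>\<close> with \<open>t0 = 0\<close> and \<open>N = 1\<close>, where its right-hand side is 0.\<close>

definition markov_chain ::
  "'b measure \<Rightarrow> ('a::polish_space \<Rightarrow> 'a measure) \<Rightarrow> 'a measure \<Rightarrow> (nat \<Rightarrow> 'b \<Rightarrow> 'a) \<Rightarrow> bool" where
  "markov_chain M P q X \<longleftrightarrow> prob_space M \<and> (\<forall>n. X n \<in> M \<rightarrow>\<^sub>M borel) \<and> distr M borel (X 0) = q \<and>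
     (\<forall>n. \<forall>A\<in>sets borel. AE \<omega> in M.
        real_cond_exp M (past M X n) (\<lambda>\<omega>. indicator A (X (Suc n) \<omega>)) \<omega> = measure (P (X n \<omega>)) A)"

end

theory Submission
  imports Defs
begin

text \<open>The law of \<open>X i\<close> is \<open>q P\<^sup>i\<close>. For a Lipschitz function \<open>f\<close> the easy half of Kantorovich duality
  shows that \<open>P\<^sup>k f\<close> is again Lipschitz, with coefficient multiplied by \<open>1 - \<kappa>\<^sub>k\<close>. Using this for
  \<open>k = j\<close> and then for \<open>k = t0 + 1\<close>, and duality once more for \<open>q\<close> and \<open>\<pi>\<close>, bounds the bias of
  \<open>f (X (t0 + 1 + j))\<close> by \<open>(1 - \<kappa>\<^bsub>t0+1\<^esub>) (1 - \<kappa>\<^sub>j) W\<^sub>1(q, \<pi>)\<close> times the Lipschitz coefficient of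
  \<open>f\<close>; summing over \<open>j\<close>
  gives the claim. Integrability of \<open>f\<close> under \<open>\<pi>\<close> comes from \<open>\<kappa>\<^sub>\<Sigma>\<^sup>c < \<infinity>\<close>: the chain started at a point
  has bounded first moments, and \<open>\<pi>\<close> inherits the bound through truncated distances. In the infinite
  cases the right-hand side is \<open>\<infinity>\<close> unless one factor vanishes, and then \<open>f\<close> is constant or \<open>X i\<close> has
  law \<open>\<pi>\<close> for all \<open>i > t0\<close>.\<close>

subsection \<open>Duality for the Wasserstein distance\<close>

lemma couplingsD:
  assumes "\<gamma> \<in> couplings \<mu> \<nu>"
  shows "(\<lambda>z. dist (fst z) (snd z)) \<in> \<gamma> \<rightarrow>\<^sub>M borel"
    "fst \<in> \<gamma> \<rightarrow>\<^sub>M borel" "snd \<in> \<gamma> \<rightarrow>\<^sub>M borel" "distr \<gamma> borel fst = \<mu>" "distr \<gamma> borel snd = \<nu>"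
proof -
  have s: "sets \<gamma> = sets (borel \<Otimes>\<^sub>M borel)"
    using assms by (simp add: couplings_def)
  show "distr \<gamma> borel fst = \<mu>" "distr \<gamma> borel snd = \<nu>"
    using assms by (simp_all add: couplings_def)
  show "(\<lambda>z. dist (fst z) (snd z)) \<in> \<gamma> \<rightarrow>\<^sub>M borel" "fst \<in> \<gamma> \<rightarrow>\<^sub>M borel" "snd \<in> \<gamma> \<rightarrow>\<^sub>M borel"
    unfolding measurable_cong_sets[OF s refl] by measurable
qed

lemma W1_approx_coupling:
  fixes \<mu> \<nu> :: "'a::polish_space measure"
  assumes "W1 \<mu> \<nu> < \<infinity>" "0 < e"
  obtains \<gamma> where "\<gamma> \<in> couplings \<mu> \<nu>"
    "(\<integral>\<^sup>+ z. ennreal (dist (fst z) (snd z)) \<partial>\<gamma>) < W1 \<mu> \<nu> + ennreal e"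
  using INF_approx_ennreal[OF assms(2) W1_def] assms(1) by (metis infinity_ennreal_def less_irrefl)

text \<open>Easy half of duality in extended form, without integrability, so that it can carry
  finiteness of first moments from one law to another: integrate
  \<open>h x \<le> h y + dist x y\<close> against a nearly optimal coupling. Having both directions
  avoids an appeal to symmetry of \<open>W1\<close>.\<close>

lemma nn_integral_lipschitz_le_W1:
  fixes h :: "'a::polish_space \<Rightarrow> real"
  assumes "1-lipschitz_on UNIV h"
  shows "(\<integral>\<^sup>+ x. ennreal (h x) \<partial>\<nu>) \<le> (\<integral>\<^sup>+ x. ennreal (h x) \<partial>\<mu>) + W1 \<mu> \<nu>" (is ?thesis1)
    and "(\<integral>\<^sup>+ x. ennreal (h x) \<partial>\<mu>) \<le> (\<integral>\<^sup>+ x. ennreal (h x) \<partial>\<nu>) + W1 \<mu> \<nu>" (is ?thesis2)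
proof -
  have hb: "h \<in> borel_measurable borel"
    using lipschitz_on_continuous_on[OF assms] by (rule borel_measurable_continuous_onI)
  have hl: "h x \<le> h y + dist x y" for x y
    using lipschitz_onD[OF assms, of x y] by (auto simp: dist_real_def)
  have "?thesis1 \<and> ?thesis2"
  proof (cases "W1 \<mu> \<nu> < \<infinity>")
    case True
    have *: "(\<integral>\<^sup>+ x. ennreal (h x) \<partial>\<nu>) \<le> (\<integral>\<^sup>+ x. ennreal (h x) \<partial>\<mu>) + W1 \<mu> \<nu> + ennreal e \<and>
      (\<integral>\<^sup>+ x. ennreal (h x) \<partial>\<mu>) \<le> (\<integral>\<^sup>+ x. ennreal (h x) \<partial>\<nu>) + W1 \<mu> \<nu> + ennreal e" if e: "0 < e" for e
    proof -
      obtain \<gamma> where \<gamma>: "\<gamma> \<in> couplings \<mu> \<nu>"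
        and le: "(\<integral>\<^sup>+ z. ennreal (dist (fst z) (snd z)) \<partial>\<gamma>) < W1 \<mu> \<nu> + ennreal e"
        using W1_approx_coupling[OF True e] by blast
      note c = couplingsD[OF \<gamma>]
      note [measurable] = c(1-3) hb
      have mu: "(\<integral>\<^sup>+ x. ennreal (h x) \<partial>\<mu>) = (\<integral>\<^sup>+ z. ennreal (h (fst z)) \<partial>\<gamma>)"
        unfolding c(4)[symmetric] by (subst nn_integral_distr) auto
      have nu: "(\<integral>\<^sup>+ x. ennreal (h x) \<partial>\<nu>) = (\<integral>\<^sup>+ z. ennreal (h (snd z)) \<partial>\<gamma>)"
        unfolding c(5)[symmetric] by (subst nn_integral_distr) auto
      \<comment> \<open>\<open>ennreal\<close> cuts negative values of \<open>h\<close> to 0; where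
        \<open>h y < 0\<close> the bound reduces to \<open>h x \<le> dist x y\<close>.\<close>
      have A: "ennreal (h x) \<le> ennreal (h y) + ennreal (dist x y)" for x y
        using hl[of x y] by (cases "0 \<le> h y") (auto simp flip: ennreal_plus simp: ennreal_neg intro!: ennreal_leI)
      let ?d = "\<integral>\<^sup>+ z. ennreal (dist (fst z) (snd z)) \<partial>\<gamma>"
      have d: "?d \<le> W1 \<mu> \<nu> + ennreal e"
        using le by (rule less_imp_le)
      have "(\<integral>\<^sup>+ z. ennreal (h (snd z)) \<partial>\<gamma>) \<le> (\<integral>\<^sup>+ z. ennreal (h (fst z)) + ennreal (dist (fst z) (snd z)) \<partial>\<gamma>)"
        using A[of "snd z" "fst z" for z] by (intro nn_integral_mono) (simp add: dist_commute)
      also have "\<dots> = (\<integral>\<^sup>+ z. ennreal (h (fst z)) \<partial>\<gamma>) + ?d"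
        by (rule nn_integral_add) auto
      also have "\<dots> \<le> (\<integral>\<^sup>+ z. ennreal (h (fst z)) \<partial>\<gamma>) + (W1 \<mu> \<nu> + ennreal e)"
        by (rule add_left_mono[OF d])
      finally have 1: "(\<integral>\<^sup>+ x. ennreal (h x) \<partial>\<nu>) \<le> (\<integral>\<^sup>+ x. ennreal (h x) \<partial>\<mu>) + W1 \<mu> \<nu> + ennreal e"
        unfolding mu nu by (simp add: add.assoc)
      have "(\<integral>\<^sup>+ z. ennreal (h (fst z)) \<partial>\<gamma>) \<le> (\<integral>\<^sup>+ z. ennreal (h (snd z)) + ennreal (dist (fst z) (snd z)) \<partial>\<gamma>)"
        by (intro nn_integral_mono A)
      also have "\<dots> = (\<integral>\<^sup>+ z. ennreal (h (snd z)) \<partial>\<gamma>) + ?d"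
        by (rule nn_integral_add) auto
      also have "\<dots> \<le> (\<integral>\<^sup>+ z. ennreal (h (snd z)) \<partial>\<gamma>) + (W1 \<mu> \<nu> + ennreal e)"
        by (rule add_left_mono[OF d])
      finally show ?thesis
        using 1 unfolding mu nu by (simp add: add.assoc)
    qed
    show ?thesis
      using *[THEN conjunct1] *[THEN conjunct2] by (intro conjI) (rule ennreal_le_epsilon, simp)+
  qed (simp add: not_less top_unique)
  then show ?thesis1 ?thesis2 by auto
qed

text \<open>Both means become integrals over one coupling of cost below \<open>w + e\<close>, under
  which the values of \<open>f\<close> at the two coordinates differ by at most \<open>L\<close>
  times their distance; then \<open>e\<close> tends to 0.\<close>

lemma integral_lipschitz_diff_le_W1:
  fixes f :: "'a::polish_space \<Rightarrow> real"
  assumes L: "L-lipschitz_on UNIV f" and \<mu>: "integrable \<mu> f" and \<nu>: "integrable \<nu> f"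
    and W: "W1 \<mu> \<nu> \<le> ennreal w" and w: "0 \<le> w"
  shows "\<bar>integral\<^sup>L \<mu> f - integral\<^sup>L \<nu> f\<bar> \<le> L * w"
proof -
  have L0: "0 \<le> L" using lipschitz_on_nonneg[OF L] .
  have hb[measurable]: "f \<in> borel_measurable borel"
    using lipschitz_on_continuous_on[OF L] by (rule borel_measurable_continuous_onI)
  have *: "\<bar>integral\<^sup>L \<mu> f - integral\<^sup>L \<nu> f\<bar> \<le> L * w + L * e" if e: "0 < e" for e
  proof -
    have "W1 \<mu> \<nu> < \<infinity>" using le_less_trans[OF W ennreal_less_top] by simp
    then obtain \<gamma> where \<gamma>: "\<gamma> \<in> couplings \<mu> \<nu>"
      and le: "(\<integral>\<^sup>+ z. ennreal (dist (fst z) (snd z)) \<partial>\<gamma>) < W1 \<mu> \<nu> + ennreal e"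
      using W1_approx_coupling[OF _ e] by blast
    note c = couplingsD[OF \<gamma>]
    note [measurable] = c(1-3)
    have i1: "integrable \<gamma> (\<lambda>z. f (fst z))" "integral\<^sup>L \<mu> f = (\<integral>z. f (fst z) \<partial>\<gamma>)"
      using \<mu> unfolding c(4)[symmetric] by (auto simp: integrable_distr_eq integral_distr)
    have i2: "integrable \<gamma> (\<lambda>z. f (snd z))" "integral\<^sup>L \<nu> f = (\<integral>z. f (snd z) \<partial>\<gamma>)"
      using \<nu> unfolding c(5)[symmetric] by (auto simp: integrable_distr_eq integral_distr)
    have le': "(\<integral>\<^sup>+ z. ennreal (dist (fst z) (snd z)) \<partial>\<gamma>) \<le> ennreal (w + e)"
      using order_trans[OF less_imp_le[OF le] add_right_mono[OF W]] e w by simp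
    then have id: "integrable \<gamma> (\<lambda>z. dist (fst z) (snd z))"
      using le_less_trans[OF le' ennreal_less_top] by (intro integrableI_nonneg) auto
    have "ennreal (\<integral>z. dist (fst z) (snd z) \<partial>\<gamma>) \<le> ennreal (w + e)"
      using le' by (subst nn_integral_eq_integral[symmetric, OF id]) auto
    then have de: "(\<integral>z. dist (fst z) (snd z) \<partial>\<gamma>) \<le> w + e"
      using e w by (subst (asm) ennreal_le_iff) auto
    have "\<bar>integral\<^sup>L \<mu> f - integral\<^sup>L \<nu> f\<bar> = \<bar>\<integral>z. f (fst z) - f (snd z) \<partial>\<gamma>\<bar>"
      using i1 i2 by simp
    also have "\<dots> \<le> (\<integral>z. \<bar>f (fst z) - f (snd z)\<bar> \<partial>\<gamma>)"
      by (rule integral_abs_bound)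
    also have "\<dots> \<le> (\<integral>z. L * dist (fst z) (snd z) \<partial>\<gamma>)"
      using i1 i2 id lipschitz_onD[OF L] by (intro integral_mono) (auto simp: dist_real_def)
    also have "\<dots> \<le> L * (w + e)"
      using de L0 by (simp add: mult_left_mono)
    finally show ?thesis by (simp add: algebra_simps)
  qed
  show ?thesis
  proof (rule field_le_epsilon)
    fix e :: real assume e: "0 < e"
    \<comment> \<open>Dividing by \<open>L + 1\<close> rather than \<open>L\<close> covers
      \<open>L = 0\<close>.\<close>
    have "L * (e / (L + 1)) \<le> e"
      using L0 e by (simp add: field_simps)
    then show "\<bar>integral\<^sup>L \<mu> f - integral\<^sup>L \<nu> f\<bar> \<le> L * w + e"
      using *[of "e / (L + 1)"] L0 e by simp
  qed
qed

text \<open>Duality at distance 0 equates the integrals of bounded Lipschitz functions. The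
  indicator of a closed set is a pointwise limit of such functions, so the measures agree on closed
  sets, an intersection-stable generator of the Borel sets.\<close>

lemma W1_eq_0_imp_eq:
  fixes \<mu> \<nu> :: "'a::polish_space measure"
  assumes \<mu>: "\<mu> \<in> space (prob_algebra borel)" and \<nu>: "\<nu> \<in> space (prob_algebra borel)"
    and W: "W1 \<mu> \<nu> = 0"
  shows "\<mu> = \<nu>"
proof -
  have s[measurable_cong]: "sets \<mu> = sets borel" "sets \<nu> = sets borel"
    using \<mu> \<nu> by (auto simp: space_prob_algebra)
  interpret \<mu>: prob_space \<mu> using \<mu> by (simp add: space_prob_algebra)
  interpret \<nu>: prob_space \<nu> using \<nu> by (simp add: space_prob_algebra)
  have sp: "space \<mu> = UNIV" "space \<nu> = UNIV"
    using s[THEN sets_eq_imp_space_eq] by auto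
  have eq: "measure \<mu> C = measure \<nu> C" if C: "closed C" for C
  proof (cases "C = {}")
    \<comment> \<open>\<open>infdist x {}\<close> is 0 by convention, so for empty \<open>C\<close>
      the functions \<open>g n\<close> below would be constantly 1; that case is split off.\<close>
    case False
    have [measurable]: "C \<in> sets borel" using C by simp
    define g where "g n x = max 0 (1 - real n * infdist x C)" for n x
    have lip: "(real n)-lipschitz_on UNIV (g n)" for n
    proof (rule lipschitz_onI)
      fix x y :: 'a
      have "\<bar>real n * infdist x C - real n * infdist y C\<bar> \<le> real n * dist x y"
        using infdist_triangle_abs[of x C y]
        by (metis abs_mult abs_of_nat mult_left_mono of_nat_0_le_iff right_diff_distrib)
      then show "dist (g n x) (g n y) \<le> real n * dist x y"
        unfolding g_def dist_real_def by linarith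
    qed simp
    have gm[measurable]: "g n \<in> borel_measurable borel" for n
      using lipschitz_on_continuous_on[OF lip] by (rule borel_measurable_continuous_onI)
    have g01: "\<bar>g n x\<bar> \<le> 1" for n x
      using infdist_nonneg[of x C] by (auto simp: g_def)
    have lim: "(\<lambda>n. g n x) \<longlonglongrightarrow> indicator C x" for x
    proof (cases "x \<in> C")
      case True then show ?thesis by (simp add: g_def)
    next
      case x: False
      then have p: "0 < infdist x C" using infdist_pos_not_in_closed[OF C False] by simp
      obtain n0 :: nat where n0: "1 < real n0 * infdist x C"
        using reals_Archimedean3[OF p] by blast
      have "eventually (\<lambda>n. g n x = 0) sequentially"
        using eventually_ge_at_top[of n0]
      proof eventually_elim
        case (elim n)
        have "real n0 * infdist x C \<le> real n * infdist x C"
          using elim p by (intro mult_right_mono) auto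
        then show ?case using n0 by (simp add: g_def)
      qed
      then show ?thesis using x by (simp add: tendsto_eventually)
    qed
    have int: "integrable \<mu> (g n)" "integrable \<nu> (g n)" for n
      using g01 by (auto intro!: \<mu>.integrable_const_bound[of _ 1] \<nu>.integrable_const_bound[of _ 1])
    have "\<bar>integral\<^sup>L \<mu> (g n) - integral\<^sup>L \<nu> (g n)\<bar> \<le> real n * 0" for n
      by (rule integral_lipschitz_diff_le_W1[OF lip int]) (auto simp: W)
    then have ge: "integral\<^sup>L \<mu> (g n) = integral\<^sup>L \<nu> (g n)" for n
      by simp
    have "(\<lambda>n. integral\<^sup>L \<mu> (g n)) \<longlonglongrightarrow> integral\<^sup>L \<mu> (indicator C)"
      using lim g01 by (intro integral_dominated_convergence[where w="\<lambda>_. 1"]) auto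
    moreover have "(\<lambda>n. integral\<^sup>L \<nu> (g n)) \<longlonglongrightarrow> integral\<^sup>L \<nu> (indicator C)"
      using lim g01 by (intro integral_dominated_convergence[where w="\<lambda>_. 1"]) auto
    ultimately have "integral\<^sup>L \<mu> (indicator C :: 'a \<Rightarrow> real) = integral\<^sup>L \<nu> (indicator C)"
      unfolding ge using LIMSEQ_unique by blast
    then show ?thesis by (simp add: sp)
  qed simp
  show ?thesis
  proof (rule measure_eqI_generator_eq[where E="Collect closed" and \<Omega>=UNIV and A="\<lambda>_. UNIV"])
    show "Int_stable (Collect closed :: 'a set set)" by (auto simp: Int_stable_def)
    show "emeasure \<mu> X = emeasure \<nu> X" if "X \<in> Collect closed" for X
      using eq[of X] that by (simp add: \<mu>.emeasure_eq_measure \<nu>.emeasure_eq_measure)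
    show "sets \<mu> = sigma_sets UNIV (Collect closed)" "sets \<nu> = sigma_sets UNIV (Collect closed)"
      unfolding s by (subst borel_eq_closed, simp)+
  qed auto
qed

text \<open>Lipschitz functions grow at most linearly in the distance to \<open>x0\<close>.\<close>

lemma integrable_lipschitz:
  fixes f :: "'a::polish_space \<Rightarrow> real"
  assumes \<mu>: "\<mu> \<in> space (prob_algebra borel)" and L: "L-lipschitz_on UNIV f"
    and fin: "(\<integral>\<^sup>+ y. ennreal (dist x0 y) \<partial>\<mu>) < \<infinity>"
  shows "integrable \<mu> f"
proof -
  have s[measurable_cong]: "sets \<mu> = sets borel"
    using \<mu> by (auto simp: space_prob_algebra)
  interpret \<mu>: prob_space \<mu> using \<mu> by (simp add: space_prob_algebra)
  have [measurable]: "f \<in> borel_measurable borel"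
    using lipschitz_on_continuous_on[OF L] by (rule borel_measurable_continuous_onI)
  have "integrable \<mu> (\<lambda>y. dist x0 y)"
    using fin by (intro integrableI_nonneg) auto
  then have i: "integrable \<mu> (\<lambda>y. \<bar>f x0\<bar> + L * dist x0 y)"
    by simp
  have "\<bar>f y\<bar> \<le> \<bar>\<bar>f x0\<bar> + L * dist x0 y\<bar>" for y
    using lipschitz_onD[OF L, of x0 y] by (auto simp: dist_real_def)
  then show ?thesis
    by (intro Bochner_Integration.integrable_bound[OF i]) auto
qed

subsection \<open>Iterated kernels\<close>

text \<open>Tonelli for \<open>bind\<close> in terms of real integrals; integrability under every
  \<open>K x\<close> and under \<open>q \<bind> K\<close> lets the extended integrals be read as
  real ones.\<close>

lemma has_bochner_integral_bind_nonneg: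
  fixes g :: "'a \<Rightarrow> real"
  assumes q: "q \<in> space (prob_algebra A)" and K: "K \<in> A \<rightarrow>\<^sub>M prob_algebra B"
    and g: "g \<in> borel_measurable B" "\<And>y. 0 \<le> g y"
    and iK: "\<And>x. x \<in> space A \<Longrightarrow> integrable (K x) g" and ib: "integrable (q \<bind> K) g"
  shows "has_bochner_integral q (\<lambda>x. integral\<^sup>L (K x) g) (integral\<^sup>L (q \<bind> K) g)"
proof (rule has_bochner_integral_nn_integral)
  have s: "sets q = sets A" "space q = space A"
    using q sets_eq_imp_space_eq by (auto simp: space_prob_algebra)
  have K': "K \<in> q \<rightarrow>\<^sub>M subprob_algebra B"
    unfolding measurable_cong_sets[OF s(1) refl] using K by (rule measurable_prob_algebraD)
  show "(\<lambda>x. integral\<^sup>L (K x) g) \<in> borel_measurable q"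
    using measurable_compose[OF K' integral_measurable_subprob_algebra[OF g(1)]] .
  have "(\<integral>\<^sup>+ x. ennreal (integral\<^sup>L (K x) g) \<partial>q) = (\<integral>\<^sup>+ x. \<integral>\<^sup>+ y. ennreal (g y) \<partial>K x \<partial>q)"
    using g(2) iK s by (intro nn_integral_cong) (subst nn_integral_eq_integral, auto)
  also have "\<dots> = (\<integral>\<^sup>+ y. ennreal (g y) \<partial>(q \<bind> K))"
    using g by (subst nn_integral_bind[OF _ K']) auto
  also have "\<dots> = ennreal (integral\<^sup>L (q \<bind> K) g)"
    using ib g(2) by (subst nn_integral_eq_integral) auto
  finally show "(\<integral>\<^sup>+ x. ennreal (integral\<^sup>L (K x) g) \<partial>q) = ennreal (integral\<^sup>L (q \<bind> K) g)" .
qed (use g in auto)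

text \<open>Positive and negative parts reduce this to the nonnegative case. Since \<open>g\<close>
  is integrable under every \<open>K x\<close>, the two inner integrals can be subtracted
  pointwise.\<close>

lemma has_bochner_integral_bind:
  fixes g :: "'a \<Rightarrow> real"
  assumes q: "q \<in> space (prob_algebra A)" and K: "K \<in> A \<rightarrow>\<^sub>M prob_algebra B"
    and g: "g \<in> borel_measurable B"
    and iK: "\<And>x. x \<in> space A \<Longrightarrow> integrable (K x) g" and ib: "integrable (q \<bind> K) g"
  shows "has_bochner_integral q (\<lambda>x. integral\<^sup>L (K x) g) (integral\<^sup>L (q \<bind> K) g)"
proof -
  have s: "space q = space A"
    using q sets_eq_imp_space_eq by (auto simp: space_prob_algebra)
  let ?p = "\<lambda>y. max 0 (g y)" and ?n = "\<lambda>y. max 0 (- g y)"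
  have dec: "integral\<^sup>L \<mu> g = integral\<^sup>L \<mu> ?p - integral\<^sup>L \<mu> ?n" if "integrable \<mu> g" for \<mu>
  proof -
    have "integral\<^sup>L \<mu> g = (\<integral>y. ?p y - ?n y \<partial>\<mu>)"
      by (rule Bochner_Integration.integral_cong) auto
    also have "\<dots> = integral\<^sup>L \<mu> ?p - integral\<^sup>L \<mu> ?n"
      using that by (intro Bochner_Integration.integral_diff integrable_max) auto
    finally show ?thesis .
  qed
  have "has_bochner_integral q (\<lambda>x. integral\<^sup>L (K x) ?p - integral\<^sup>L (K x) ?n)
     (integral\<^sup>L (q \<bind> K) ?p - integral\<^sup>L (q \<bind> K) ?n)"
    using g iK ib by (intro has_bochner_integral_diff has_bochner_integral_bind_nonneg[OF q K] integrable_max) auto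
  then have "has_bochner_integral q (\<lambda>x. integral\<^sup>L (K x) ?p - integral\<^sup>L (K x) ?n)
     (integral\<^sup>L (q \<bind> K) g)"
    by (simp add: dec[OF ib])
  then show ?thesis
    by (rule has_bochner_integral_cong[THEN iffD1, rotated -1]) (auto simp: dec iK s)
qed

lemma kernel_pow_measurable:
  assumes "P \<in> borel \<rightarrow>\<^sub>M prob_algebra borel"
  shows "kernel_pow P k \<in> borel \<rightarrow>\<^sub>M prob_algebra borel"
proof (induction k)
  case 0
  have "kernel_pow P 0 = return borel" by (rule ext) simp
  then show ?case by simp
next
  case (Suc k)
  have "kernel_pow P (Suc k) = (\<lambda>x. kernel_pow P k x \<bind> P)" by (rule ext) simp
  then show ?case using measurable_bind_prob_space[OF Suc assms] by simp
qed

lemma kernel_pow_in_prob_algebra: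
  assumes "P \<in> borel \<rightarrow>\<^sub>M prob_algebra borel"
  shows "kernel_pow P k x \<in> space (prob_algebra borel)"
  using measurable_space[OF kernel_pow_measurable[OF assms]] by simp

lemma bind_kernel_assoc:
  assumes "q \<in> space (prob_algebra borel)" "K \<in> borel \<rightarrow>\<^sub>M prob_algebra borel"
    and "P \<in> borel \<rightarrow>\<^sub>M prob_algebra borel"
  shows "(q \<bind> K) \<bind> P = q \<bind> (\<lambda>x. K x \<bind> P)"
proof -
  have s: "sets q = sets borel" using assms(1) by (simp add: space_prob_algebra)
  have "K \<in> q \<rightarrow>\<^sub>M subprob_algebra borel"
    unfolding measurable_cong_sets[OF s refl] using assms(2) by (rule measurable_prob_algebraD)
  then show ?thesis
    by (rule bind_assoc) (rule measurable_prob_algebraD[OF assms(3)])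
qed

lemma bind_in_prob_algebra:
  assumes "q \<in> space (prob_algebra A)" "K \<in> A \<rightarrow>\<^sub>M prob_algebra B"
  shows "q \<bind> K \<in> space (prob_algebra B)"
proof -
  \<comment> \<open>Viewing \<open>q \<bind> K\<close> as a constant family over a one-point space
    turns measurability into membership.\<close>
  have "(\<lambda>_. q \<bind> K) \<in> count_space {()} \<rightarrow>\<^sub>M prob_algebra B"
    using assms by (intro measurable_bind_prob_space[where N=A] measurable_const) auto
  then show ?thesis by (auto dest: measurable_space)
qed

lemma bind_kernel_pow_Suc:
  assumes "P \<in> borel \<rightarrow>\<^sub>M prob_algebra borel" "q \<in> space (prob_algebra borel)"
  shows "q \<bind> kernel_pow P (Suc k) = (q \<bind> kernel_pow P k) \<bind> P"
  using bind_kernel_assoc[OF assms(2) kernel_pow_measurable[OF assms(1)] assms(1)]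
  by (simp add: kernel_pow.simps(2)[abs_def])

text \<open>Chapman-Kolmogorov, by induction on \<open>n\<close> because \<open>kernel_pow\<close>
  appends each new step at the end.\<close>

lemma kernel_pow_add:
  assumes P: "P \<in> borel \<rightarrow>\<^sub>M prob_algebra borel"
  shows "kernel_pow P (m + n) x = kernel_pow P m x \<bind> kernel_pow P n"
proof (induction n)
  case 0
  have "kernel_pow P 0 = return borel" by (rule ext) simp
  then show ?case
    using kernel_pow_in_prob_algebra[OF P, of m x] by (simp add: bind_return'' space_prob_algebra)
next
  case (Suc n)
  show ?case
    unfolding add_Suc_right kernel_pow.simps(2) Suc
    using bind_kernel_assoc[OF kernel_pow_in_prob_algebra[OF P] kernel_pow_measurable[OF P] P] by simp
qed

lemma stationary_bind_kernel_pow: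
  assumes "P \<in> borel \<rightarrow>\<^sub>M prob_algebra borel" "stationary P \<pi>"
  shows "\<pi> \<bind> kernel_pow P k = \<pi>"
proof (induction k)
  case 0
  have "kernel_pow P 0 = return borel" by (rule ext) simp
  then show ?case using assms by (simp add: bind_return'' stationary_def space_prob_algebra)
next
  case (Suc k)
  then have "\<pi> \<bind> kernel_pow P (Suc k) = \<pi> \<bind> P"
    using assms by (simp only: bind_kernel_pow_Suc stationary_def)
  then show ?case using assms by (simp only: stationary_def)
qed

section \<open>Law of the chain at a fixed time\<close>

lemma subalgebra_past:
  assumes "\<And>n. X n \<in> M \<rightarrow>\<^sub>M borel"
  shows "subalgebra M (past M X n)"
proof -
  have "{X i -` A \<inter> space M | i A. i \<le> n \<and> A \<in> sets borel} \<subseteq> sets M"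
    using measurable_sets[OF assms] by auto
  moreover from this have "sigma_sets (space M) {X i -` A \<inter> space M | i A. i \<le> n \<and> A \<in> sets borel} \<subseteq> sets M"
    by (rule sets.sigma_sets_subset)
  ultimately show ?thesis
    using sets.sets_into_space unfolding subalgebra_def past_def
    by (subst sets_measure_of) (auto simp: space_measure_of_conv)
qed

text \<open>Conditional expectation given the past preserves the mean, so the probability that
  \<open>X (Suc n)\<close> lies in \<open>A\<close> is the mean of
  \<open>measure (P (X n \<omega>)) A\<close>. Hence each step binds the current law with
  \<open>P\<close>.\<close>

lemma markov_chain_law:
  assumes P: "P \<in> borel \<rightarrow>\<^sub>M prob_algebra borel" and q: "q \<in> space (prob_algebra borel)"
    and chain: "markov_chain M P q X"
  shows "distr M borel (X n) = q \<bind> kernel_pow P n"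
proof (induction n)
  case 0
  have "kernel_pow P 0 = return borel" by (rule ext) simp
  then show ?case using q chain by (simp add: bind_return'' space_prob_algebra markov_chain_def)
next
  case (Suc n)
  interpret prob_space M using chain by (simp add: markov_chain_def)
  have X[measurable]: "X n \<in> M \<rightarrow>\<^sub>M borel" for n
    using chain by (simp add: markov_chain_def)
  interpret finite_measure_subalgebra M "past M X n"
    by unfold_locales (rule subalgebra_past[OF X])
  have D: "distr M borel (X n) \<in> space (prob_algebra borel)" for n
    by (simp add: space_prob_algebra prob_space_distr)
  have "distr M borel (X (Suc n)) = distr M borel (X n) \<bind> P"
  proof (rule measure_eqI)
    show "sets (distr M borel (X (Suc n))) = sets (distr M borel (X n) \<bind> P)"
      using bind_in_prob_algebra[OF D P] by (simp add: space_prob_algebra)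
    fix A assume "A \<in> sets (distr M borel (X (Suc n)))"
    then have A[measurable]: "A \<in> sets borel" by simp
    have PA: "(\<lambda>x. measure (P x) A) \<in> borel_measurable borel"
      using measurable_compose[OF P measurable_measure_prob_algebra[OF A]] .
    have Pp: "P x \<in> space (prob_algebra borel)" for x using measurable_space[OF P] by simp
    then have Ppr: "prob_space (P x)" for x by (simp add: space_prob_algebra)
    have ind: "integrable M (\<lambda>\<omega>. indicator A (X (Suc n) \<omega>) :: real)"
      by (rule integrable_const_bound[of _ 1]) (auto simp: indicator_def)
    have ae: "AE \<omega> in M. real_cond_exp M (past M X n) (\<lambda>\<omega>. indicator A (X (Suc n) \<omega>)) \<omega> = measure (P (X n \<omega>)) A"
      using chain A by (simp add: markov_chain_def)
    have "measure (distr M borel (X (Suc n))) A = (\<integral>y. indicator A y \<partial>distr M borel (X (Suc n)))"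
      by simp
    also have "\<dots> = (\<integral>\<omega>. indicator A (X (Suc n) \<omega>) \<partial>M)"
      by (subst integral_distr) auto
    also have "\<dots> = (\<integral>\<omega>. real_cond_exp M (past M X n) (\<lambda>\<omega>. indicator A (X (Suc n) \<omega>)) \<omega> \<partial>M)"
      using real_cond_exp_int(2)[OF ind] by simp
    also have "\<dots> = (\<integral>\<omega>. measure (P (X n \<omega>)) A \<partial>M)"
      using ae measurable_compose[OF X PA] borel_measurable_integrable[OF real_cond_exp_int(1)[OF ind]]
      by (intro integral_cong_AE) auto
    finally have 1: "measure (distr M borel (X (Suc n))) A = (\<integral>\<omega>. measure (P (X n \<omega>)) A \<partial>M)" .
    have "integrable M (\<lambda>\<omega>. measure (P (X n \<omega>)) A)"
      using measurable_compose[OF X PA] Ppr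
      by (intro integrable_const_bound[of _ 1]) (auto simp: prob_space.prob_le_1)
    then have "ennreal (\<integral>\<omega>. measure (P (X n \<omega>)) A \<partial>M) = (\<integral>\<^sup>+\<omega>. ennreal (measure (P (X n \<omega>)) A) \<partial>M)"
      by (subst nn_integral_eq_integral) auto
    also have "\<dots> = (\<integral>\<^sup>+x. ennreal (measure (P x) A) \<partial>distr M borel (X n))"
      using PA by (subst nn_integral_distr) auto
    also have "\<dots> = (\<integral>\<^sup>+x. emeasure (P x) A \<partial>distr M borel (X n))"
      using Ppr by (intro nn_integral_cong) (simp add: finite_measure.emeasure_eq_measure prob_space.finite_measure)
    also have "\<dots> = emeasure (distr M borel (X n) \<bind> P) A"
      using emeasure_bind_prob_algebra[OF D P A] by simp
    finally show "emeasure (distr M borel (X (Suc n))) A = emeasure (distr M borel (X n) \<bind> P) A"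
      using 1 prob_space_distr[OF X, of "Suc n"]
      by (simp add: finite_measure.emeasure_eq_measure prob_space.finite_measure)
  qed
  then show ?case by (simp only: bind_kernel_pow_Suc[OF P q] Suc)
qed

subsection \<open>Contraction by iterated kernels\<close>

lemma lipschitz_dist: "1-lipschitz_on UNIV (dist x)"
proof (rule lipschitz_onI)
  show "dist (dist x y) (dist x z) \<le> 1 * dist y z" for y z
    using abs_dist_diff_le[of y x z] by (simp add: dist_real_def dist_commute)
qed simp

text \<open>The diagonal value 1 of \<open>curv_at\<close> caps the infimum;
  \<open>undefined\<close> is just some point of the space.\<close>

lemma curv_nonneg: "0 \<le> 1 - curv P k"
proof -
  have "curv P k \<le> curv_at P k undefined undefined"
    unfolding curv_def by (intro INF_lower2[of undefined] UNIV_I order_refl)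
  then have "curv P k \<le> 1" by (simp add: curv_at_def)
  then show ?thesis by (simp add: ereal_diff_positive)
qed

text \<open>Unfolds the infimum that defines the curvature. On the diagonal \<open>curv_at\<close>
  is fixed by convention and says nothing about \<open>W1\<close>, hence
  \<open>x \<noteq> y\<close>; callers treat equal points directly.\<close>

lemma W1_kernel_pow_le:
  assumes c: "1 - curv P k = ereal c" and "x \<noteq> y"
  shows "W1 (kernel_pow P k x) (kernel_pow P k y) \<le> ennreal (c * dist x y)"
proof -
  let ?W = "W1 (kernel_pow P k x) (kernel_pow P k y)"
  let ?a = "enn2ereal ?W / ereal (dist x y)"
  have d: "0 < dist x y" using assms by simp
  have "curv P k \<le> curv_at P k x y"
    unfolding curv_def by (intro INF_lower2[of x] INF_lower2[of y] UNIV_I order_refl)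
  then have "1 - curv_at P k x y \<le> 1 - curv P k"
    by (intro ereal_minus_mono) auto
  \<comment> \<open>Cancellation in \<open>ereal\<close> survives an infinite \<open>?a\<close>
    because the other summand is finite.\<close>
  moreover have "1 - (1 - ?a) = ?a"
    by (cases ?a) (auto simp: one_ereal_def)
  ultimately have "?a \<le> ereal c"
    using \<open>x \<noteq> y\<close> c by (simp add: curv_at_def)
  then have "enn2ereal ?W \<le> ereal (c * dist x y)"
    using d by (simp add: ereal_divide_le_pos mult.commute)
  then have "e2ennreal (enn2ereal ?W) \<le> e2ennreal (ereal (c * dist x y))"
    by (rule e2ennreal_mono)
  then show ?thesis by (simp add: e2ennreal_enn2ereal)
qed

text \<open>A vanishing contraction factor forces distance 0 between the \<open>k\<close>-step laws,
  and \<open>W1\<close> separates probability measures. This serves the degenerate case in which the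
  chain forgets its start.\<close>

lemma curv_const:
  assumes P: "P \<in> borel \<rightarrow>\<^sub>M prob_algebra borel" and c: "1 - curv P k = 0"
  shows "kernel_pow P k x = kernel_pow P k y"
proof (cases "x = y")
  case False
  have "W1 (kernel_pow P k x) (kernel_pow P k y) \<le> ennreal (0 * dist x y)"
    using c False by (intro W1_kernel_pow_le) (auto simp: zero_ereal_def)
  then show ?thesis
    by (intro W1_eq_0_imp_eq kernel_pow_in_prob_algebra P) simp
qed simp

text \<open>The term \<open>k = 0\<close> is already positive, since distinct points have distinct
  Dirac measures. In the infinite case of the bound this rules out a product of 0 and
  \<infinity>.\<close>

lemma curv_sum_c_pos:
  fixes P :: "'a::polish_space \<Rightarrow> 'a measure"
  assumes P: "P \<in> borel \<rightarrow>\<^sub>M prob_algebra borel" and xy: "(x :: 'a) \<noteq> y"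
  shows "0 < curv_sum_c P"
proof -
  have "1 - curv P 0 \<noteq> 0"
  proof
    assume "1 - curv P 0 = 0"
    then have "return borel x = return borel y"
      using curv_const[OF P, of 0 x y] by simp
    then have "emeasure (return borel x) {x} = emeasure (return borel y) {x}" by simp
    then show False using xy by simp
  qed
  then have "0 < 1 - curv P 0" using curv_nonneg[of P 0] by simp
  also have "\<dots> = (\<Sum>k<Suc 0. 1 - curv P k)" by simp
  also have "\<dots> \<le> curv_sum_c P"
    unfolding curv_sum_c_def by (rule suminf_upper[OF curv_nonneg])
  finally show ?thesis .
qed

text \<open>A finite sum of nonnegative extended reals has finite terms, which allows real
  contraction factors \<open>c k\<close> from here on.\<close>

lemma curv_sum_c_finite:
  assumes "curv_sum_c P \<noteq> \<infinity>"
  obtains c where "\<And>k. 1 - curv P k = ereal (c k)" "\<And>k. 0 \<le> c k" "summable c"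
    "curv_sum_c P = ereal (suminf c)"
proof -
  have "1 - curv P k \<noteq> \<infinity>" for k
    using assms suminf_PInfty[where f="\<lambda>k. 1 - curv P k", OF curv_nonneg] unfolding curv_sum_c_def by blast
  then have "\<exists>c. 1 - curv P k = ereal c" for k
    using curv_nonneg[of P k] by (cases "1 - curv P k") auto
  then obtain c where c: "\<And>k. 1 - curv P k = ereal (c k)" by metis
  have c0: "0 \<le> c k" for k using curv_nonneg[of P k] by (simp add: c)
  have S: "curv_sum_c P = (\<Sum>k. ereal (c k))" by (simp add: curv_sum_c_def c)
  have "summable c"
    using assms c0 by (intro summable_ereal) (auto simp: S)
  moreover from this have "curv_sum_c P = ereal (suminf c)"
    unfolding S using c0 by (intro suminf_ereal') auto
  ultimately show ?thesis using that c c0 by blast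
qed

section \<open>First moments under finite contraction factors\<close>

context
  fixes P :: "'a::polish_space \<Rightarrow> 'a measure" and c :: "nat \<Rightarrow> real"
  assumes P: "P \<in> borel \<rightarrow>\<^sub>M prob_algebra borel"
    and first_step: "\<And>x. W1 (return borel x) (P x) < \<infinity>"
    and c: "\<And>k. 1 - curv P k = ereal (c k)"
begin

lemma contraction_nonneg: "0 \<le> c k"
  using curv_nonneg[of P k] by (simp add: c)

text \<open>Compares the starts \<open>x\<close> and \<open>x0\<close> by duality for the
  1-Lipschitz function \<open>dist x0\<close>.\<close>

lemma nn_integral_dist_kernel_pow_le:
  "(\<integral>\<^sup>+ y. ennreal (dist x0 y) \<partial>kernel_pow P k x)
    \<le> (\<integral>\<^sup>+ y. ennreal (dist x0 y) \<partial>kernel_pow P k x0) + ennreal (c k * dist x0 x)"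
proof (cases "x = x0")
  case False
  from nn_integral_lipschitz_le_W1(1)[OF lipschitz_dist[of x0], of "kernel_pow P k x" "kernel_pow P k x0"]
  have "(\<integral>\<^sup>+ y. ennreal (dist x0 y) \<partial>kernel_pow P k x)
    \<le> (\<integral>\<^sup>+ y. ennreal (dist x0 y) \<partial>kernel_pow P k x0) + W1 (kernel_pow P k x0) (kernel_pow P k x)" .
  also have "\<dots> \<le> (\<integral>\<^sup>+ y. ennreal (dist x0 y) \<partial>kernel_pow P k x0) + ennreal (c k * dist x0 x)"
    using False by (intro add_left_mono W1_kernel_pow_le c) auto
  finally show ?thesis .
qed simp

lemma nn_integral_dist_kernel_le_W1:
  "(\<integral>\<^sup>+ y. ennreal (dist x0 y) \<partial>P x0) \<le> W1 (return borel x0) (P x0)"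
proof -
  from nn_integral_lipschitz_le_W1(1)[OF lipschitz_dist[of x0], of "P x0" "return borel x0"]
  show ?thesis by (simp add: nn_integral_return)
qed

lemma nn_integral_bind_kernel_pow:
  assumes "q \<in> space (prob_algebra borel)" "f \<in> borel_measurable borel"
  shows "(\<integral>\<^sup>+ y. f y \<partial>(q \<bind> kernel_pow P k)) = (\<integral>\<^sup>+ x. \<integral>\<^sup>+ y. f y \<partial>kernel_pow P k x \<partial>q)"
proof -
  have s: "sets q = sets borel" using assms(1) by (simp add: space_prob_algebra)
  show ?thesis
    using measurable_prob_algebraD[OF kernel_pow_measurable[OF P]] assms(2)
    by (intro nn_integral_bind[where B=borel]) (auto simp: measurable_cong_sets[OF s refl])
qed

lemma nn_integral_dist_bind_kernel_pow_le:
  assumes q: "q \<in> space (prob_algebra borel)"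
  shows "(\<integral>\<^sup>+ y. ennreal (dist x0 y) \<partial>(q \<bind> kernel_pow P k))
    \<le> (\<integral>\<^sup>+ y. ennreal (dist x0 y) \<partial>kernel_pow P k x0) + ennreal (c k) * (\<integral>\<^sup>+ y. ennreal (dist x0 y) \<partial>q)"
proof -
  have s[measurable_cong]: "sets q = sets borel" using q by (simp add: space_prob_algebra)
  interpret q: prob_space q using q by (simp add: space_prob_algebra)
  let ?m = "\<integral>\<^sup>+ y. ennreal (dist x0 y) \<partial>kernel_pow P k x0"
  have "(\<integral>\<^sup>+ y. ennreal (dist x0 y) \<partial>(q \<bind> kernel_pow P k))
      = (\<integral>\<^sup>+ x. \<integral>\<^sup>+ y. ennreal (dist x0 y) \<partial>kernel_pow P k x \<partial>q)"
    by (rule nn_integral_bind_kernel_pow[OF q]) measurable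
  also have "\<dots> \<le> (\<integral>\<^sup>+ x. ?m + ennreal (c k) * ennreal (dist x0 x) \<partial>q)"
    using nn_integral_dist_kernel_pow_le by (intro nn_integral_mono) (simp add: ennreal_mult' contraction_nonneg)
  also have "\<dots> = ?m + ennreal (c k) * (\<integral>\<^sup>+ y. ennreal (dist x0 y) \<partial>q)"
    by (subst nn_integral_add) (auto simp: nn_integral_cmult q.emeasure_space_1)
  finally show ?thesis .
qed

text \<open>Run one step from \<open>x0\<close> and then \<open>k\<close> more: compared with
  \<open>k\<close> steps from \<open>x0\<close> itself, the displaced start adds at most
  \<open>c k\<close> times the mean length of the first step. These increments add up over the
  induction.\<close>

lemma kernel_pow_moment:
  "(\<integral>\<^sup>+ y. ennreal (dist x0 y) \<partial>kernel_pow P k x0) \<le> ennreal (\<Sum>i<k. c i) * W1 (return borel x0) (P x0)"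
proof (induction k)
  case 0
  then show ?case by (simp add: nn_integral_return)
next
  case (Suc k)
  have Px: "P x0 \<in> space (prob_algebra borel)" using measurable_space[OF P] by simp
  have "kernel_pow P 1 x0 = P x0"
    using bind_return[OF measurable_prob_algebraD[OF P]] by simp
  \<comment> \<open>\<open>kernel_pow\<close> adds steps at the end; Chapman-Kolmogorov brings the
    first step to the front.\<close>
  then have "kernel_pow P (Suc k) x0 = P x0 \<bind> kernel_pow P k"
    using kernel_pow_add[OF P, of 1 k x0] by simp
  then have "(\<integral>\<^sup>+ y. ennreal (dist x0 y) \<partial>kernel_pow P (Suc k) x0)
    \<le> (\<integral>\<^sup>+ y. ennreal (dist x0 y) \<partial>kernel_pow P k x0) + ennreal (c k) * (\<integral>\<^sup>+ y. ennreal (dist x0 y) \<partial>P x0)"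
    using nn_integral_dist_bind_kernel_pow_le[OF Px] by simp
  also have "\<dots> \<le> ennreal (\<Sum>i<k. c i) * W1 (return borel x0) (P x0) + ennreal (c k) * W1 (return borel x0) (P x0)"
    by (intro add_mono Suc mult_left_mono nn_integral_dist_kernel_le_W1) auto
  also have "\<dots> = ennreal (\<Sum>i<Suc k. c i) * W1 (return borel x0) (P x0)"
    using contraction_nonneg by (simp add: ennreal_plus sum_nonneg distrib_right)
  finally show ?case .
qed

lemma kernel_pow_moment_finite: "(\<integral>\<^sup>+ y. ennreal (dist x0 y) \<partial>kernel_pow P k x) < \<infinity>"
proof -
  have "(\<integral>\<^sup>+ y. ennreal (dist x0 y) \<partial>kernel_pow P k x0) < \<infinity>"
    by (rule le_less_trans[OF kernel_pow_moment])
      (use first_step[of x0] in \<open>simp add: ennreal_mult_less_top\<close>)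
  then show ?thesis
    using le_less_trans[OF nn_integral_dist_kernel_pow_le] by simp
qed

text \<open>By stationarity the \<pi>-mean of a truncated distance equals its mean after
  \<open>n\<close> further steps, which is at most a constant \<open>C\<close> plus a term that
  vanishes as \<open>n\<close> grows. The truncation keeps that term finite before the limit, and
  \<open>C\<close> does not depend on the truncation level.\<close>

lemma stationary_moment_finite:
  assumes st: "stationary P \<pi>" and sm: "summable c"
  shows "(\<integral>\<^sup>+ y. ennreal (dist x0 y) \<partial>\<pi>) < \<infinity>"
proof -
  have \<pi>: "\<pi> \<in> space (prob_algebra borel)" using st by (simp add: stationary_def)
  have s[measurable_cong]: "sets \<pi> = sets borel" using \<pi> by (simp add: space_prob_algebra)
  interpret \<pi>: prob_space \<pi> using \<pi> by (simp add: space_prob_algebra)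
  \<comment> \<open>A moment bound for the chain from \<open>x0\<close> valid at all times, as
    partial sums of \<open>c\<close> stay below \<open>suminf c\<close>.\<close>
  define C where "C = ennreal (suminf c) * W1 (return borel x0) (P x0)"
  have C: "C < \<infinity>"
    using first_step[of x0] by (simp add: C_def ennreal_mult_less_top)
  have mC: "(\<integral>\<^sup>+ y. ennreal (dist x0 y) \<partial>kernel_pow P n x0) \<le> C" for n
  proof (rule order_trans[OF kernel_pow_moment])
    show "ennreal (\<Sum>i<n. c i) * W1 (return borel x0) (P x0) \<le> C"
      unfolding C_def using sm contraction_nonneg by (intro mult_right_mono ennreal_leI sum_le_suminf) auto
  qed
  have trunc: "(\<integral>\<^sup>+ y. ennreal (min (dist x0 y) (real R)) \<partial>\<pi>) \<le> C" for R :: nat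
  proof -
    have bound: "(\<integral>\<^sup>+ y. ennreal (min (dist x0 y) (real R)) \<partial>\<pi>)
      \<le> C + (\<integral>\<^sup>+ x. ennreal (min (c n * dist x0 x) (real R)) \<partial>\<pi>)" for n
    proof -
      have inner: "(\<integral>\<^sup>+ y. ennreal (min (dist x0 y) (real R)) \<partial>kernel_pow P n x)
          \<le> C + ennreal (min (c n * dist x0 x) (real R))" for x
      proof -
        interpret K: prob_space "kernel_pow P n x"
          using kernel_pow_in_prob_algebra[OF P, of n x] by (simp add: space_prob_algebra)
        have "(\<integral>\<^sup>+ y. ennreal (min (dist x0 y) (real R)) \<partial>kernel_pow P n x)
            \<le> (\<integral>\<^sup>+ y. ennreal (real R) \<partial>kernel_pow P n x)"
          by (intro nn_integral_mono ennreal_leI) auto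
        then have 1: "(\<integral>\<^sup>+ y. ennreal (min (dist x0 y) (real R)) \<partial>kernel_pow P n x) \<le> ennreal (real R)"
          by (simp add: K.emeasure_space_1)
        have "(\<integral>\<^sup>+ y. ennreal (min (dist x0 y) (real R)) \<partial>kernel_pow P n x)
            \<le> (\<integral>\<^sup>+ y. ennreal (dist x0 y) \<partial>kernel_pow P n x)"
          by (intro nn_integral_mono ennreal_leI) auto
        also have "\<dots> \<le> (\<integral>\<^sup>+ y. ennreal (dist x0 y) \<partial>kernel_pow P n x0) + ennreal (c n * dist x0 x)"
          by (rule nn_integral_dist_kernel_pow_le)
        also have "\<dots> \<le> C + ennreal (c n * dist x0 x)"
          by (intro add_right_mono mC)
        finally have 2: "(\<integral>\<^sup>+ y. ennreal (min (dist x0 y) (real R)) \<partial>kernel_pow P n x) \<le> C + ennreal (c n * dist x0 x)" .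
        have 3: "(\<integral>\<^sup>+ y. ennreal (min (dist x0 y) (real R)) \<partial>kernel_pow P n x) \<le> C + ennreal (real R)"
          by (rule order_trans[OF 1]) simp
        \<comment> \<open>The minimum equals one of its two arguments: bound 2 serves the first,
          bound 3 the second.\<close>
        show ?thesis
          by (cases "c n * dist x0 x \<le> real R") (use 2 3 in \<open>simp_all add: min_def\<close>)
      qed
      have "(\<integral>\<^sup>+ y. ennreal (min (dist x0 y) (real R)) \<partial>\<pi>)
        = (\<integral>\<^sup>+ y. ennreal (min (dist x0 y) (real R)) \<partial>(\<pi> \<bind> kernel_pow P n))"
        using stationary_bind_kernel_pow[OF P st] by simp
      also have "\<dots> = (\<integral>\<^sup>+ x. \<integral>\<^sup>+ y. ennreal (min (dist x0 y) (real R)) \<partial>kernel_pow P n x \<partial>\<pi>)"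
        by (rule nn_integral_bind_kernel_pow[OF \<pi>]) measurable
      also have "\<dots> \<le> (\<integral>\<^sup>+ x. C + ennreal (min (c n * dist x0 x) (real R)) \<partial>\<pi>)"
        by (intro nn_integral_mono inner)
      also have "\<dots> = C + (\<integral>\<^sup>+ x. ennreal (min (c n * dist x0 x) (real R)) \<partial>\<pi>)"
        by (subst nn_integral_add) (auto simp: \<pi>.emeasure_space_1)
      finally show ?thesis .
    qed
    \<comment> \<open>Now \<open>n\<close> tends to infinity with \<open>R\<close> fixed:
      \<open>c n\<close> tends to 0, and \<open>R\<close> is the dominating constant.\<close>
    have c0: "c \<longlonglongrightarrow> 0" using sm by (rule summable_LIMSEQ_zero)
    have "(\<lambda>n. \<integral>\<^sup>+ x. ennreal (min (c n * dist x0 x) (real R)) \<partial>\<pi>) \<longlonglongrightarrow> (\<integral>\<^sup>+ x. 0 \<partial>\<pi>)"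
    proof (rule nn_integral_dominated_convergence[where w="\<lambda>_. ennreal (real R)"])
      show "AE x in \<pi>. (\<lambda>n. ennreal (min (c n * dist x0 x) (real R))) \<longlonglongrightarrow> 0"
      proof (rule AE_I2)
        fix x
        have "(\<lambda>n. min (c n * dist x0 x) (real R)) \<longlonglongrightarrow> min (0 * dist x0 x) (real R)"
          by (intro tendsto_intros c0)
        then show "(\<lambda>n. ennreal (min (c n * dist x0 x) (real R))) \<longlonglongrightarrow> 0"
          by (auto dest: tendsto_ennrealI)
      qed
    qed (auto intro!: ennreal_leI simp: \<pi>.emeasure_space_1)
    then have "(\<lambda>n. C + (\<integral>\<^sup>+ x. ennreal (min (c n * dist x0 x) (real R)) \<partial>\<pi>)) \<longlonglongrightarrow> C + 0"
      by (intro tendsto_add tendsto_const) simp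
    then show ?thesis
      by (intro LIMSEQ_le_const[of _ C]) (use bound in auto)
  qed
  \<comment> \<open>Monotone convergence in \<open>R\<close> removes the truncation.\<close>
  have "(\<lambda>R. \<integral>\<^sup>+ y. ennreal (min (dist x0 y) (real R)) \<partial>\<pi>) \<longlonglongrightarrow> (\<integral>\<^sup>+ y. ennreal (dist x0 y) \<partial>\<pi>)"
  proof (rule nn_integral_LIMSEQ)
    show "incseq (\<lambda>R y. ennreal (min (dist x0 y) (real R)))"
      by (auto simp: incseq_def le_fun_def intro!: ennreal_leI)
    fix y
    obtain n0 :: nat where "dist x0 y \<le> real n0" using real_arch_simple by blast
    then have "eventually (\<lambda>R. ennreal (min (dist x0 y) (real R)) = ennreal (dist x0 y)) sequentially"
      by (intro eventually_sequentiallyI[of n0]) (simp add: min_def)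
    then show "(\<lambda>R. ennreal (min (dist x0 y) (real R))) \<longlonglongrightarrow> ennreal (dist x0 y)"
      by (rule tendsto_eventually)
  qed measurable
  then have "(\<integral>\<^sup>+ y. ennreal (dist x0 y) \<partial>\<pi>) \<le> C"
    by (rule LIMSEQ_le_const2) (use trunc in auto)
  then show ?thesis using C by (rule le_less_trans)
qed

section \<open>Lipschitz observables along the iterated kernels\<close>

lemma lipschitz_kernel_pow:
  fixes f :: "'a \<Rightarrow> real"
  assumes f: "L-lipschitz_on UNIV f"
  shows "(c k * L)-lipschitz_on UNIV (\<lambda>x. integral\<^sup>L (kernel_pow P k x) f)"
proof (rule lipschitz_onI)
  have L0: "0 \<le> L" using lipschitz_on_nonneg[OF f] .
  then show "0 \<le> c k * L" using contraction_nonneg by simp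
  fix x y :: 'a
  show "dist (integral\<^sup>L (kernel_pow P k x) f) (integral\<^sup>L (kernel_pow P k y) f) \<le> c k * L * dist x y"
  proof (cases "x = y")
    case False
    have "\<bar>integral\<^sup>L (kernel_pow P k x) f - integral\<^sup>L (kernel_pow P k y) f\<bar> \<le> L * (c k * dist x y)"
      using W1_kernel_pow_le[OF c False] contraction_nonneg
      by (intro integral_lipschitz_diff_le_W1[OF f])
        (auto intro!: integrable_lipschitz[OF kernel_pow_in_prob_algebra[OF P] f kernel_pow_moment_finite])
    then show ?thesis by (simp add: dist_real_def mult_ac)
  qed simp
qed

text \<open>A finite first moment of \<open>q\<close> passes to the law after \<open>k\<close>
  steps, so all integrals in Fubini for \<open>bind\<close> exist.\<close>

lemma integrable_bind_kernel_pow: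
  fixes f :: "'a \<Rightarrow> real"
  assumes f: "L-lipschitz_on UNIV f" and q: "q \<in> space (prob_algebra borel)"
    and fin: "(\<integral>\<^sup>+ y. ennreal (dist x0 y) \<partial>q) < \<infinity>"
  shows "integrable (q \<bind> kernel_pow P k) f"
    and "(\<integral>x. integral\<^sup>L (kernel_pow P k x) f \<partial>q) = integral\<^sup>L (q \<bind> kernel_pow P k) f"
proof -
  have K: "kernel_pow P k \<in> borel \<rightarrow>\<^sub>M prob_algebra borel" by (rule kernel_pow_measurable[OF P])
  have fb: "f \<in> borel_measurable borel"
    using lipschitz_on_continuous_on[OF f] by (rule borel_measurable_continuous_onI)
  have "(\<integral>\<^sup>+ y. ennreal (dist x0 y) \<partial>(q \<bind> kernel_pow P k)) < \<infinity>"
    using nn_integral_dist_bind_kernel_pow_le[OF q]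
    by (rule le_less_trans) (use fin kernel_pow_moment_finite[where x0=x0 and x=x0 and k=k] in \<open>simp add: ennreal_mult_less_top\<close>)
  with f show i: "integrable (q \<bind> kernel_pow P k) f"
    by (rule integrable_lipschitz[OF bind_in_prob_algebra[OF q K]])
  show "(\<integral>x. integral\<^sup>L (kernel_pow P k x) f \<partial>q) = integral\<^sup>L (q \<bind> kernel_pow P k) f"
    by (intro has_bochner_integral_integral_eq has_bochner_integral_bind[OF q K fb _ i]
        integrable_lipschitz[OF kernel_pow_in_prob_algebra[OF P] f kernel_pow_moment_finite])
qed

text \<open>Under \<pi> the mean of \<open>f\<close> is the same after any number of steps, so the
  bias compares the means of a single function, the \<open>s + j\<close> step average of
  \<open>f\<close>, under \<open>q\<close> and \<pi>. Cutting the steps into \<open>s\<close> and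
  \<open>j\<close> makes \<open>c s\<close> a common factor for all \<open>j\<close>, ready for
  summation.\<close>

lemma bias_after_steps:
  fixes f :: "'a \<Rightarrow> real"
  assumes st: "stationary P \<pi>" and sm: "summable c" and f: "L-lipschitz_on UNIV f"
    and q: "q \<in> space (prob_algebra borel)" and W: "W1 q \<pi> = ennreal w" and w: "0 \<le> w"
  shows "integrable (q \<bind> kernel_pow P (s + j)) f"
    and "\<bar>integral\<^sup>L (q \<bind> kernel_pow P (s + j)) f - integral\<^sup>L \<pi> f\<bar> \<le> c s * (c j * L) * w"
proof -
  fix x0 :: 'a
  have \<pi>: "\<pi> \<in> space (prob_algebra borel)" using st by (simp add: stationary_def)
  have fin\<pi>: "(\<integral>\<^sup>+ y. ennreal (dist x0 y) \<partial>\<pi>) < \<infinity>"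
    by (rule stationary_moment_finite[OF st sm])
  \<comment> \<open>Duality for \<open>dist x0\<close> transfers the finite moment of \<pi> to
    \<open>q\<close>, because \<open>W1 q \<pi>\<close> is finite.\<close>
  have finq: "(\<integral>\<^sup>+ y. ennreal (dist x0 y) \<partial>q) < \<infinity>"
    by (rule le_less_trans[OF nn_integral_lipschitz_le_W1(2)[OF lipschitz_dist[of x0], of q \<pi>]]) (use fin\<pi> W in auto)
  show "integrable (q \<bind> kernel_pow P (s + j)) f"
    by (rule integrable_bind_kernel_pow[OF f q finq])
  let ?T = "\<lambda>x. integral\<^sup>L (kernel_pow P (s + j) x) f"
  \<comment> \<open>The \<open>s + j\<close> step average is an \<open>s\<close> step average of a
    \<open>j\<close> step average, so the contraction lemma applies twice.\<close>
  have T: "?T x = (\<integral>y. integral\<^sup>L (kernel_pow P j y) f \<partial>kernel_pow P s x)" for x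
    unfolding kernel_pow_add[OF P]
    by (rule integrable_bind_kernel_pow(2)[OF f kernel_pow_in_prob_algebra[OF P] kernel_pow_moment_finite, symmetric])
  have Tl: "(c s * (c j * L))-lipschitz_on UNIV ?T"
    unfolding T by (rule lipschitz_kernel_pow[OF lipschitz_kernel_pow[OF f]])
  have "\<bar>integral\<^sup>L q ?T - integral\<^sup>L \<pi> ?T\<bar> \<le> c s * (c j * L) * w"
    using W w by (intro integral_lipschitz_diff_le_W1[OF Tl] integrable_lipschitz[OF q Tl finq]
      integrable_lipschitz[OF \<pi> Tl fin\<pi>]) auto
  then show "\<bar>integral\<^sup>L (q \<bind> kernel_pow P (s + j)) f - integral\<^sup>L \<pi> f\<bar> \<le> c s * (c j * L) * w"
    unfolding integrable_bind_kernel_pow(2)[OF f q finq] integrable_bind_kernel_pow(2)[OF f \<pi> fin\<pi>]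
      stationary_bind_kernel_pow[OF P st] .
qed

end

subsection \<open>The Lipschitz coefficient\<close>

text \<open>A supremum of reals is meaningful only for a bounded family; any Lipschitz constant
  \<open>L\<close> bounds the quotients, including the value 0 at equal points.\<close>

lemma lip_coeff_lipschitz:
  fixes f :: "'a::metric_space \<Rightarrow> real"
  assumes "L-lipschitz_on UNIV f"
  shows "(lip_coeff f)-lipschitz_on UNIV f"
proof -
  have bdd: "bdd_above ((\<lambda>(x, y). \<bar>f x - f y\<bar> / dist x y) ` UNIV)"
  proof (rule bdd_aboveI2[of _ _ L], clarify)
    fix x y :: 'a
    show "\<bar>f x - f y\<bar> / dist x y \<le> L"
      using lipschitz_onD[OF assms, of x y] lipschitz_on_nonneg[OF assms]
      by (cases "x = y") (auto simp: dist_real_def field_simps)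
  qed
  have le: "\<bar>f x - f y\<bar> / dist x y \<le> lip_coeff f" for x y
    unfolding lip_coeff_def using cSUP_upper[OF _ bdd, of "(x, y)"] by simp
  show ?thesis
  proof (rule lipschitz_onI)
    fix x y :: 'a
    show "dist (f x) (f y) \<le> lip_coeff f * dist x y"
      using le[of x y] by (cases "x = y") (auto simp: dist_real_def field_simps)
  next
    show "0 \<le> lip_coeff f" using le[of undefined undefined] by simp
  qed
qed

subsection \<open>The bias bound\<close>

lemma integral_average_eq:
  fixes f :: "'a::polish_space \<Rightarrow> real"
  assumes X: "\<And>n. X n \<in> M \<rightarrow>\<^sub>M borel" and f: "f \<in> borel_measurable borel"
    and int: "\<And>i. i \<in> I \<Longrightarrow> integrable (distr M borel (X i)) f"
  shows "(\<integral>\<omega>. a * (\<Sum>i\<in>I. f (X i \<omega>)) \<partial>M) = a * (\<Sum>i\<in>I. integral\<^sup>L (distr M borel (X i)) f)"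
  using int by (simp add: integrable_distr_eq[OF X f] integral_distr[OF X f])

text \<open>In \<open>ereal\<close> the product of 0 and \<infinity> is 0, hence the strict
  positivity of all factors.\<close>

lemma ereal_mult_eq_top:
  fixes a b c d :: ereal
  assumes "0 < a" "0 < b" "0 < c" "0 < d" "0 < r" "b = \<infinity> \<or> c = \<infinity>"
  shows "a * b / ereal r * c * d = \<infinity>"
  using assms by (cases a; cases b; cases c; cases d) auto

theorem proposition3p19:
  fixes P :: "'a::polish_space \<Rightarrow> 'a measure"
    and \<pi> q :: "'a measure"
    and M :: "'b measure"
    and X :: "nat \<Rightarrow> 'b \<Rightarrow> 'a"
    and f :: "'a \<Rightarrow> real"
    and Z :: "'b \<Rightarrow> real"
    and N t0 :: nat
  assumes kernel: "P \<in> borel \<rightarrow>\<^sub>M prob_algebra borel"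
    and first_step: "\<And>x. W1 (return borel x) (P x) < \<infinity>"
    and stat: "stationary P \<pi>"
    and initial: "q \<in> space (prob_algebra borel)"
    and chain: "markov_chain M P q X"
    and burn_in: "t0 < N"
    and lip: "\<exists>L. L-lipschitz_on UNIV f"
    and mean_exists: "curv_sum_c P = \<infinity> \<Longrightarrow> integrable \<pi> f"
    and Z_def: "\<And>\<omega>. Z \<omega> = 1 / real (N - t0) * (\<Sum>i=t0+1..N. f (X i \<omega>))"
  shows "ereal \<bar>integral\<^sup>L M Z - integral\<^sup>L \<pi> f\<bar>
    \<le> (1 - curv P (t0 + 1)) * curv_sum_c P / ereal (real (N - t0)) * enn2ereal (W1 q \<pi>) * ereal (lip_coeff f)"
proof -
  let ?c = "1 - curv P (t0 + 1)"
  let ?rhs = "?c * curv_sum_c P / ereal (real (N - t0)) * enn2ereal (W1 q \<pi>) * ereal (lip_coeff f)"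
  obtain L0 where L0: "L0-lipschitz_on UNIV f" using lip by blast
  have fl: "(lip_coeff f)-lipschitz_on UNIV f" by (rule lip_coeff_lipschitz[OF L0])
  have l0: "0 \<le> lip_coeff f" using lipschitz_on_nonneg[OF fl] .
  have fb: "f \<in> borel_measurable borel"
    using lipschitz_on_continuous_on[OF fl] by (rule borel_measurable_continuous_onI)
  have \<pi>: "\<pi> \<in> space (prob_algebra borel)" using stat by (simp add: stationary_def)
  have X: "X n \<in> M \<rightarrow>\<^sub>M borel" for n using chain by (simp add: markov_chain_def)
  interpret M: prob_space M using chain by (simp add: markov_chain_def)
  interpret \<pi>: prob_space \<pi> using \<pi> by (simp add: space_prob_algebra)
  interpret q: prob_space q using initial by (simp add: space_prob_algebra)
  have n0: "0 < real (N - t0)" using burn_in by simp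
  have S0: "0 \<le> curv_sum_c P"
    unfolding curv_sum_c_def by (rule suminf_0_le[OF curv_nonneg])
  have rhs0: "0 \<le> ?rhs"
    using l0 n0 by (intro ereal_0_le_mult zero_le_divide_ereal curv_nonneg S0) auto
  \<comment> \<open>The state with index \<open>t0 + 1 + j\<close> is \<open>t0 + 1\<close> steps
    and then \<open>j\<close> more away from \<open>q\<close>, with \<open>j\<close> starting at 0
    like the index of \<open>curv_sum_c\<close>.\<close>
  have reindex: "(\<Sum>i=t0+1..N. g i) = (\<Sum>j<N - t0. g (t0 + 1 + j))" for g :: "nat \<Rightarrow> real"
    by (rule sum.reindex_bij_witness[where i="\<lambda>j. t0 + 1 + j" and j="\<lambda>i. i - (t0 + 1)"])
      (use burn_in in auto)
  have avg: "integral\<^sup>L M Z = 1 / real (N - t0) * (\<Sum>j<N - t0. integral\<^sup>L (q \<bind> kernel_pow P (t0 + 1 + j)) f)"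
    if "\<And>j. integrable (q \<bind> kernel_pow P (t0 + 1 + j)) f"
  proof -
    have "integrable (distr M borel (X i)) f" if "i \<in> {t0 + 1..N}" for i
      using \<open>\<And>j. integrable (q \<bind> kernel_pow P (t0 + 1 + j)) f\<close>[of "i - (t0 + 1)"] that
      by (simp add: markov_chain_law[OF kernel initial chain])
    then have "integral\<^sup>L M Z = 1 / real (N - t0) * (\<Sum>i=t0+1..N. integral\<^sup>L (distr M borel (X i)) f)"
      unfolding Z_def by (rule integral_average_eq[OF X fb])
    then show ?thesis
      unfolding reindex by (simp only: markov_chain_law[OF kernel initial chain])
  qed
  \<comment> \<open>A finite curvature sum yields a first moment of \<pi>; for an infinite sum
    integrability is the hypothesis \<open>mean_exists\<close>.\<close>
  have f\<pi>: "integrable \<pi> f"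
  proof (cases "curv_sum_c P = \<infinity>")
    case False
    obtain c where c: "\<And>k. 1 - curv P k = ereal (c k)" "summable c"
      using curv_sum_c_finite[OF False] by metis
    show ?thesis
      by (rule integrable_lipschitz[OF \<pi> fl stationary_moment_finite[OF kernel first_step c(1) stat c(2), of undefined]])
  qed (rule mean_exists)
  \<comment> \<open>If every averaged state has law \<pi>, the bias is 0, and nonnegativity of the
    right-hand side suffices whatever its factors are.\<close>
  have bias0: ?thesis if "\<And>j. q \<bind> kernel_pow P (t0 + 1 + j) = \<pi>"
  proof -
    have "integral\<^sup>L M Z = integral\<^sup>L \<pi> f"
      using avg that f\<pi> n0 by simp
    then show ?thesis using rhs0 by (simp add: zero_ereal_def)
  qed
  \<comment> \<open>A zero factor annihilates an infinite one in \<open>ereal\<close>, so vanishing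
    factors come first, each with bias 0. Otherwise an infinite factor makes the bound trivial, or
    all factors are finite.\<close>
  consider "lip_coeff f = 0" | "?c = 0" | "W1 q \<pi> = 0"
    | "0 < lip_coeff f" "0 < ?c" "0 < W1 q \<pi>" "curv_sum_c P = \<infinity> \<or> W1 q \<pi> = \<infinity>"
    | "curv_sum_c P \<noteq> \<infinity>" "W1 q \<pi> \<noteq> \<infinity>"
    using l0 curv_nonneg[of P "t0 + 1"] by (metis less_eq_real_def zero_less_iff_neq_zero order_le_less)
  then show ?thesis
  proof cases
    case 1
    obtain k where k: "f = (\<lambda>_. k)"
    proof
      show "f = (\<lambda>_. f undefined)"
        using lipschitz_onD[OF fl, of _ undefined] by (intro ext) (simp add: 1)
    qed
    have "Z = (\<lambda>_. k)"
      using n0 by (intro ext) (simp add: Z_def k)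
    moreover have "integral\<^sup>L \<pi> f = k"
      unfolding k by (simp add: \<pi>.prob_space)
    ultimately have "integral\<^sup>L M Z = integral\<^sup>L \<pi> f"
      by (simp add: M.prob_space)
    then show ?thesis using rhs0 by (simp add: zero_ereal_def)
  next
    case 2
    let ?\<rho> = "kernel_pow P (t0 + 1) undefined"
    have \<rho>: "subprob_space ?\<rho>"
      using kernel_pow_in_prob_algebra[OF kernel, of "t0 + 1" undefined]
      by (simp add: space_prob_algebra prob_space_imp_subprob_space)
    \<comment> \<open>After \<open>t0 + 1\<close> steps the law is the same from every start.
      Starting from \<pi> identifies it as \<pi>.\<close>
    have k: "kernel_pow P (t0 + 1) = (\<lambda>_. ?\<rho>)"
      by (rule ext, rule curv_const[OF kernel 2])
    have "q \<bind> kernel_pow P (t0 + 1) = ?\<rho>"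
      by (subst k, rule bind_const'[OF q.prob_space_axioms \<rho>])
    moreover have "\<pi> \<bind> kernel_pow P (t0 + 1) = ?\<rho>"
      by (subst k, rule bind_const'[OF \<pi>.prob_space_axioms \<rho>])
    ultimately have q\<pi>: "q \<bind> kernel_pow P (t0 + 1) = \<pi>"
      using stationary_bind_kernel_pow[OF kernel stat, of "t0 + 1"] by metis
    show ?thesis
    proof (rule bias0)
      fix j
      have "q \<bind> kernel_pow P (t0 + 1 + j) = (q \<bind> kernel_pow P (t0 + 1)) \<bind> kernel_pow P j"
        unfolding bind_kernel_assoc[OF initial kernel_pow_measurable[OF kernel] kernel_pow_measurable[OF kernel]]
        by (intro bind_cong refl kernel_pow_add[OF kernel])
      also have "\<dots> = \<pi>"
        unfolding q\<pi> by (rule stationary_bind_kernel_pow[OF kernel stat])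
      finally show "q \<bind> kernel_pow P (t0 + 1 + j) = \<pi>" .
    qed
  next
    case 3
    then have "q = \<pi>" by (rule W1_eq_0_imp_eq[OF initial \<pi>])
    then show ?thesis
      by (intro bias0) (simp only: stationary_bind_kernel_pow[OF kernel stat])
  next
    case 4
    \<comment> \<open>A positive Lipschitz coefficient needs two points, as all quotients on a
      one-point space are \<open>0 / 0 = 0\<close>. Two points in turn make
      \<open>curv_sum_c P\<close> positive.\<close>
    have "\<exists>x y :: 'a. x \<noteq> y"
    proof (rule ccontr)
      assume "\<nexists>x y :: 'a. x \<noteq> y"
      then have d: "dist x y = 0" for x y :: 'a
        by simp
      have "lip_coeff f = 0" unfolding lip_coeff_def d by simp
      then show False using 4 by simp
    qed
    then have "0 < curv_sum_c P" using curv_sum_c_pos[OF kernel] by blast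
    moreover have "0 < enn2ereal (W1 q \<pi>)"
      using 4(3) by (simp add: less_ennreal.rep_eq zero_ennreal.rep_eq)
    moreover have "curv_sum_c P = \<infinity> \<or> enn2ereal (W1 q \<pi>) = \<infinity>"
      using 4(4) by (auto simp: top_ennreal.rep_eq top_ereal_def)
    ultimately have "?rhs = \<infinity>"
      using 4 n0 by (intro ereal_mult_eq_top) auto
    then show ?thesis by simp
  next
    case 5
    obtain c where c: "\<And>k. 1 - curv P k = ereal (c k)" "\<And>k. 0 \<le> c k" "summable c"
      and S: "curv_sum_c P = ereal (suminf c)"
      using curv_sum_c_finite[OF 5(1)] by metis
    define w where "w = enn2real (W1 q \<pi>)"
    have w: "0 \<le> w" "W1 q \<pi> = ennreal w"
      using 5(2) by (auto simp: w_def less_top)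
    let ?n = "real (N - t0)" and ?e = "\<lambda>j. integral\<^sup>L (q \<bind> kernel_pow P (t0 + 1 + j)) f"
    note bias = bias_after_steps[OF kernel first_step c(1) stat c(3) fl initial w(2,1), of "t0 + 1"]
    have "integral\<^sup>L M Z - integral\<^sup>L \<pi> f = 1 / ?n * (\<Sum>j<N - t0. ?e j - integral\<^sup>L \<pi> f)"
      using n0 by (subst avg[OF bias(1)]) (simp add: sum_subtractf field_simps)
    then have "\<bar>integral\<^sup>L M Z - integral\<^sup>L \<pi> f\<bar> = 1 / ?n * \<bar>\<Sum>j<N - t0. ?e j - integral\<^sup>L \<pi> f\<bar>"
      using n0 by (simp add: abs_mult)
    also have "\<dots> \<le> 1 / ?n * (\<Sum>j<N - t0. c (t0 + 1) * (c j * lip_coeff f) * w)"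
      using n0 by (intro mult_left_mono order_trans[OF sum_abs] sum_mono bias(2)) auto
    also have "\<dots> = 1 / ?n * (c (t0 + 1) * lip_coeff f * w * (\<Sum>j<N - t0. c j))"
      by (simp add: sum_distrib_left mult_ac)
    \<comment> \<open>Only the first \<open>N - t0\<close> contraction factors occur; the remaining
      nonnegative ones are added to reach the full sum.\<close>
    also have "\<dots> \<le> 1 / ?n * (c (t0 + 1) * lip_coeff f * w * suminf c)"
      using n0 c l0 w by (intro mult_left_mono sum_le_suminf) auto
    also have "\<dots> = c (t0 + 1) * suminf c / ?n * w * lip_coeff f"
      by (simp add: mult_ac)
    finally show ?thesis
      using n0 w(1) by (simp add: c(1) S w(2) enn2ereal_ennreal del: of_nat_diff)
  qed
qed

end
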